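(* Let $\Bbbk$ be a field of arbitrary characteristic. Let $R$ and $S$ be standard graded polynomial rings over $\Bbbk$ of positive Krull dimension, with graded maximal ideals $\mathfrak m$ and $\mathfrak n$, and let $T=R\otimes_\Bbbk S$. Let $I\subseteq\mathfrak m^2$ and $J\subseteq\mathfrak n^2$ be homogeneous ideals of $R$ and $S$, respectively, at least one of which is non-zero, and let $F=I+J+\mathfrak m\mathfrak n\subseteq T$. Then for all $s\ge 2$, $\operatorname{depth}(T/F^s)=0$.
   Context: Ideals of $R$ and $S$ are identified with their extensions to $T$, so $F=IT+JT+(\mathfrak mT)(\mathfrak nT)$. Depth is taken with respect to the graded maximal ideal. *)

theory Defs
  imports
    "HOL-Algebra.Algebra"
    "HOL-Algebra.Algebraic_Closure_Type"
    "HOL-Library.Poly_Mapping"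
    "HOL-Library.Extended_Nat"
begin

section \<open>Standard graded polynomial rings\<close>

text \<open>
  \<open>('v, 'k) mpoly\<close> is the polynomial ring over \<open>'k\<close> in the variables \<open>'v\<close>; a monomial is its
  finitely supported exponent vector. For a finite type \<open>'v\<close> (types are never empty) the Krull
  dimension of this ring is the positive number \<open>CARD('v)\<close>.
\<close>

type_synonym ('v, 'k) mpoly = "('v \<Rightarrow>\<^sub>0 nat) \<Rightarrow>\<^sub>0 'k"

abbreviation mpoly_ring :: "('v, 'k::field) mpoly ring"
  where "mpoly_ring \<equiv> ring_of_type_algebra"

definition mon_deg :: "('v \<Rightarrow>\<^sub>0 nat) \<Rightarrow> nat"
  where "mon_deg m = (\<Sum>v\<in>Poly_Mapping.keys m. Poly_Mapping.lookup m v)"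

definition hom_component :: "nat \<Rightarrow> ('v, 'k::field) mpoly \<Rightarrow> ('v, 'k) mpoly"
  where "hom_component d p =
    (\<Sum>m\<in>{m \<in> Poly_Mapping.keys p. mon_deg m = d}.
       Poly_Mapping.single m (Poly_Mapping.lookup p m))"

definition homogeneous_ideal :: "('v, 'k::field) mpoly set \<Rightarrow> bool"
  where "homogeneous_ideal I \<longleftrightarrow>
    ideal I mpoly_ring \<and> (\<forall>p\<in>I. \<forall>d. hom_component d p \<in> I)"

text \<open>The graded maximal ideal is the sum of all graded pieces of positive degree.\<close>

definition graded_max_ideal :: "('v, 'k::field) mpoly set"
  where "graded_max_ideal = {p. \<forall>m\<in>Poly_Mapping.keys p. 0 < mon_deg m}"

lemma mon_deg_eq_0_iff: "mon_deg m = 0 \<longleftrightarrow> m = 0"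
  by (auto simp: mon_deg_def in_keys_iff intro!: poly_mapping_eqI)

lemma graded_max_ideal_alt: "p \<in> graded_max_ideal \<longleftrightarrow> Poly_Mapping.lookup p 0 = 0"
proof -
  have "p \<in> graded_max_ideal \<longleftrightarrow> (\<forall>m\<in>Poly_Mapping.keys p. m \<noteq> 0)"
    by (auto simp: graded_max_ideal_def mon_deg_eq_0_iff simp flip: neq0_conv)
  then show ?thesis
    by (metis in_keys_iff)
qed

section \<open>The tensor product of two polynomial rings\<close>

text \<open>
  The tensor product over \<open>'k\<close> of the polynomial rings in the variables \<open>'x\<close> and \<open>'y\<close> is the
  polynomial ring in the variables \<open>'x + 'y\<close>, with structure maps \<open>rename Inl\<close> and \<open>rename Inr\<close>.
  This is justified by \<open>rename_ring_hom\<close>, \<open>rename_tensor_single\<close> and \<open>tensor_basis\<close> below: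
  the products of the images of the monomials of the two factors are,
  without repetition, the monomials in the variables \<open>'x + 'y\<close>.
\<close>

definition rename_mon :: "('v \<Rightarrow> 'w) \<Rightarrow> ('v \<Rightarrow>\<^sub>0 nat) \<Rightarrow> ('w \<Rightarrow>\<^sub>0 nat)"
  where "rename_mon f m =
    (\<Sum>v\<in>Poly_Mapping.keys m. Poly_Mapping.single (f v) (Poly_Mapping.lookup m v))"

definition rename :: "('v \<Rightarrow> 'w) \<Rightarrow> ('v, 'k::field) mpoly \<Rightarrow> ('w, 'k) mpoly"
  where "rename f p =
    (\<Sum>m\<in>Poly_Mapping.keys p. Poly_Mapping.single (rename_mon f m) (Poly_Mapping.lookup p m))"

lemma rename_mon_superset:
  assumes "finite A" "Poly_Mapping.keys m \<subseteq> A"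
  shows "rename_mon f m = (\<Sum>v\<in>A. Poly_Mapping.single (f v) (Poly_Mapping.lookup m v))"
  unfolding rename_mon_def using assms
  by (intro sum.mono_neutral_left) (auto simp: in_keys_iff)

lemma rename_superset:
  assumes "finite A" "Poly_Mapping.keys p \<subseteq> A"
  shows "rename f p =
    (\<Sum>m\<in>A. Poly_Mapping.single (rename_mon f m) (Poly_Mapping.lookup p m))"
  unfolding rename_def using assms
  by (intro sum.mono_neutral_left) (auto simp: in_keys_iff)

lemma rename_mon_add: "rename_mon f (a + b) = rename_mon f a + rename_mon f b"
  using keys_add[of a b]
  by (simp add: rename_mon_superset[of "Poly_Mapping.keys a \<union> Poly_Mapping.keys b"]
      lookup_add single_add sum.distrib)

lemma rename_mon_0 [simp]: "rename_mon f 0 = 0"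
  by (simp add: rename_mon_def)

lemma rename_0 [simp]: "rename f 0 = 0"
  by (simp add: rename_def)

lemma rename_add: "rename f (p + q) = rename f p + rename f q"
  using keys_add[of p q]
  by (simp add: rename_superset[of "Poly_Mapping.keys p \<union> Poly_Mapping.keys q"]
      lookup_add single_add sum.distrib)

lemma rename_sum: "rename f (sum g A) = (\<Sum>x\<in>A. rename f (g x))"
  by (induction A rule: infinite_finite_induct) (auto simp: rename_add)

lemma rename_single [simp]:
  "rename f (Poly_Mapping.single m c) = Poly_Mapping.single (rename_mon f m) c"
  by (cases "c = 0") (auto simp: rename_def)

lemma mpoly_sum_single:
  "(\<Sum>m\<in>Poly_Mapping.keys p. Poly_Mapping.single m (Poly_Mapping.lookup p m)) = p"
  by (rule poly_mapping_eqI)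
    (auto simp: lookup_sum lookup_single when_def in_keys_iff sum.delta)

lemma rename_mult: "rename f (p * q) = rename f p * rename f q"
proof -
  have "rename f (p * q) =
    rename f ((\<Sum>m\<in>Poly_Mapping.keys p. Poly_Mapping.single m (Poly_Mapping.lookup p m)) *
              (\<Sum>m\<in>Poly_Mapping.keys q. Poly_Mapping.single m (Poly_Mapping.lookup q m)))"
    by (simp only: mpoly_sum_single)
  also have "\<dots> = rename f p * rename f q"
    by (simp add: sum_product rename_sum mult_single rename_mon_add)
      (simp add: rename_def sum_product mult_single)
  finally show ?thesis .
qed

lemma rename_ring_hom: "rename f \<in> ring_hom mpoly_ring mpoly_ring"
  by (rule ring_hom_memI)
    (auto simp: ring_of_type_algebra_def rename_add rename_mult simp flip: single_one)

lemma rename_tensor_single: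
  "rename Inl (Poly_Mapping.single a c) * rename Inr (Poly_Mapping.single b d) =
    Poly_Mapping.single (rename_mon Inl a + rename_mon Inr b) (c * d)"
  by (simp add: mult_single)

lemma lookup_rename_mon:
  assumes "inj f"
  shows "Poly_Mapping.lookup (rename_mon f m) (f v) = Poly_Mapping.lookup m v"
  using assms
  by (auto simp: rename_mon_def lookup_sum lookup_single when_def inj_eq in_keys_iff sum.delta)

lemma lookup_rename_mon_notin:
  "w \<notin> range f \<Longrightarrow> Poly_Mapping.lookup (rename_mon f m) w = 0"
  by (auto simp: rename_mon_def lookup_sum lookup_single when_def)

lemma tensor_basis:
  "bij (\<lambda>(a :: 'x \<Rightarrow>\<^sub>0 nat, b :: 'y \<Rightarrow>\<^sub>0 nat). rename_mon Inl a + rename_mon Inr b)"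
proof (rule o_bij)
  let ?g = "\<lambda>c. (Poly_Mapping.map_key Inl c, Poly_Mapping.map_key Inr c)"
  let ?h = "\<lambda>(a :: 'x \<Rightarrow>\<^sub>0 nat, b :: 'y \<Rightarrow>\<^sub>0 nat). rename_mon Inl a + rename_mon Inr b"
  have *: "Poly_Mapping.lookup (rename_mon Inl a) (Inr y) = 0"
          "Poly_Mapping.lookup (rename_mon Inr b) (Inl x) = 0"
    for a :: "'x \<Rightarrow>\<^sub>0 nat" and b :: "'y \<Rightarrow>\<^sub>0 nat" and x :: 'x and y :: 'y
    by (auto intro!: lookup_rename_mon_notin)
  show "?g \<circ> ?h = id"
    by (auto simp: fun_eq_iff map_key.rep_eq lookup_add lookup_rename_mon *
        intro!: poly_mapping_eqI)
  show "?h \<circ> ?g = id"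
  proof
    fix c :: "'x + 'y \<Rightarrow>\<^sub>0 nat"
    show "(?h \<circ> ?g) c = id c"
    proof (rule poly_mapping_eqI)
      fix w show "Poly_Mapping.lookup ((?h \<circ> ?g) c) w = Poly_Mapping.lookup (id c) w"
        by (cases w) (auto simp: map_key.rep_eq lookup_add lookup_rename_mon *)
    qed
  qed
qed

section \<open>Depth\<close>

text \<open>
  The submodule \<open>A M\<close> generated by all products of elements of \<open>A\<close> and \<open>M\<close>. For
  \<open>A = {x\<^sub>1, \<dots>, x\<^sub>r}\<close> it is \<open>(x\<^sub>1, \<dots>, x\<^sub>r) M\<close>.
\<close>

definition smult_submodule ::
    "('a, 'r) ring_scheme \<Rightarrow> 'a set \<Rightarrow> ('a, 'b, 'm) module_scheme \<Rightarrow> 'b set"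
  where "smult_submodule R A M =
    \<Inter> {N. submodule N R M \<and> (\<forall>a\<in>A. \<forall>m\<in>carrier M. a \<odot>\<^bsub>M\<^esub> m \<in> N)}"

text \<open>
  \<open>x\<^sub>i\<close> is a nonzerodivisor on \<open>M / (x\<^sub>1, \<dots>, x\<^sub>i\<^sub>-\<^sub>1) M\<close>, and \<open>(x\<^sub>1, \<dots>, x\<^sub>r) M \<noteq> M\<close>.
\<close>

definition regular_sequence ::
    "('a, 'r) ring_scheme \<Rightarrow> ('a, 'b, 'm) module_scheme \<Rightarrow> 'a list \<Rightarrow> bool"
  where "regular_sequence R M xs \<longleftrightarrow>
    set xs \<subseteq> carrier R \<and>
    (\<forall>i<length xs. \<forall>m\<in>carrier M.
       (xs ! i) \<odot>\<^bsub>M\<^esub> m \<in> smult_submodule R (set (take i xs)) M \<longrightarrow>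
       m \<in> smult_submodule R (set (take i xs)) M) \<and>
    smult_submodule R (set xs) M \<noteq> carrier M"

text \<open>
  The depth of \<open>M\<close> with respect to an ideal \<open>A\<close>, with the usual convention that it is infinite
  if \<open>A M = M\<close> (in particular, if \<open>M = 0\<close>).
\<close>

definition depth ::
    "('a, 'r) ring_scheme \<Rightarrow> 'a set \<Rightarrow> ('a, 'b, 'm) module_scheme \<Rightarrow> enat"
  where "depth R A M =
    (if smult_submodule R A M = carrier M then \<infinity>
     else SUP xs \<in> {xs. set xs \<subseteq> A \<and> regular_sequence R M xs}. enat (length xs))"

text \<open>The quotient ring \<open>R / I\<close> as an \<open>R\<close>-module.\<close>

definition quot_module :: "('a, 'r) ring_scheme \<Rightarrow> 'a set \<Rightarrow> ('a, 'a set) module"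
  where "quot_module R I =
    \<lparr>carrier = carrier (R Quot I), monoid.mult = monoid.mult (R Quot I), one = one (R Quot I),
     ring.zero = ring.zero (R Quot I), add = add (R Quot I),
     module.smult = (\<lambda>a x. monoid.mult (R Quot I) (I +>\<^bsub>R\<^esub> a) x)\<rparr>"

lemma quot_module_is_module:
  assumes "cring R" "ideal I R"
  shows "module R (quot_module R I)"
proof -
  interpret R: cring R by fact
  interpret I: ideal I R by fact
  interpret Q: cring "R Quot I" by (rule I.quotient_is_cring) fact
  have hom: "(+>\<^bsub>R\<^esub>) I \<in> ring_hom R (R Quot I)" by (rule I.rcos_ring_hom)
  note h = ring_hom_closed[OF hom] ring_hom_add[OF hom] ring_hom_mult[OF hom] ring_hom_one[OF hom]
  show ?thesis
  proof (rule moduleI)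
    show "abelian_group (quot_module R I)"
      by (rule abelian_groupI) (auto simp: quot_module_def Q.a_ac intro: Q.add.l_inv_ex[simplified])
  qed (use assms in \<open>auto simp: quot_module_def h Q.l_distr Q.r_distr Q.m_assoc\<close>)
qed

end

theory Submission
  imports Defs
begin

text \<open>
  It suffices to find an element of \<open>T\<close> outside \<open>F\<^sup>s\<close> that is multiplied into \<open>F\<^sup>s\<close> by every
  variable. By symmetry let \<open>I \<noteq> 0\<close>, and let \<open>d \<ge> 2\<close> be the least degree of a monomial occurring
  in some \<open>f \<in> I\<close>. For variables \<open>x\<close> of \<open>R\<close> and \<open>y\<close> of \<open>S\<close>, the element
  \<open>u = f y (x y)\<^sup>s\<^sup>-\<^sup>2\<close> does it: \<open>x' u = f (x y)\<^sup>s\<^sup>-\<^sup>2 (x' y)\<close> lies in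
  \<open>I (\<mm>\<nn>)\<^sup>s\<^sup>-\<^sup>1\<close>, and \<open>y' u = (f y y') (x y)\<^sup>s\<^sup>-\<^sup>2\<close> lies in \<open>(\<mm>\<nn>)\<^sup>s\<close> because
  \<open>f \<in> \<mm>\<^sup>2\<close>. Give the variables of \<open>R\<close> weight \<open>1\<close> and those of \<open>S\<close> weight
  \<open>d - 1\<close>. Then \<open>I\<close>, \<open>J\<close> and \<open>\<mm>\<nn>\<close> have weights at least \<open>d\<close>, so \<open>F\<^sup>s\<close> has weights at least
  \<open>s d\<close>, while \<open>u\<close> has a monomial of weight \<open>s d - 1\<close>.
\<close>

section \<open>Depth zero from an annihilated element\<close>

lemma smult_submodule_empty:
  assumes "module R M"
  shows "smult_submodule R {} M = {\<zero>\<^bsub>M\<^esub>}"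
proof -
  interpret module R M by fact
  have "submodule {\<zero>\<^bsub>M\<^esub>} R M"
    by (rule submoduleI) auto
  moreover have "\<zero>\<^bsub>M\<^esub> \<in> N" if "submodule N R M" for N
    using submodule.axioms(1)[OF that, THEN subgroup.one_closed] by simp
  ultimately show ?thesis
    unfolding smult_submodule_def by blast
qed

text \<open>The class of \<open>u\<close> is non-zero and killed by all of \<open>A\<close>, so no
  element of \<open>A\<close> can start a regular sequence. The inclusion
  \<open>K \<subseteq> A\<close> with \<open>A\<close> proper rules out the case where the depth is
  infinite by convention.\<close>

lemma depth_quot_module_eq_0:
  fixes R (structure)
  assumes "cring R" and "ideal A R" and "ideal K R" and "K \<subseteq> A" and "A \<noteq> carrier R"
    and u: "u \<in> carrier R" "u \<notin> K" and socle: "\<And>a. a \<in> A \<Longrightarrow> a \<otimes>\<^bsub>R\<^esub> u \<in> K"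
  shows "depth R A (quot_module R K) = 0"
proof -
  interpret cring R by fact
  interpret A: ideal A R by fact
  interpret K: ideal K R by fact
  let ?M = "quot_module R K"
  interpret M: module R ?M
    by (rule quot_module_is_module) fact+
  have carrier_quot [simp]: "carrier ?M = (+>) K ` carrier R" and [simp]: "\<zero>\<^bsub>?M\<^esub> = K"
    by (auto simp: quot_module_def FactRing_def A_RCOSETS_def')
  have smult: "a \<odot>\<^bsub>?M\<^esub> (K +> b) = K +> (a \<otimes> b)" if "a \<in> carrier R" "b \<in> carrier R" for a b
    using that by (simp add: quot_module_def FactRing_def K.rcoset_mult_add)
  have add: "(K +> a) \<oplus>\<^bsub>?M\<^esub> (K +> b) = K +> (a \<oplus> b)"
    if "a \<in> carrier R" "b \<in> carrier R" for a b
    using that by (simp add: quot_module_def FactRing_def K.a_rcos_sum)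
  have zero: "K +> a = K \<longleftrightarrow> a \<in> K" if "a \<in> carrier R" for a
    using that K.a_rcos_const K.rcos_const_imp_mem by blast
  have inv: "\<ominus>\<^bsub>?M\<^esub> (K +> a) = K +> (\<ominus> a)" if "a \<in> carrier R" for a
  proof (rule M.minus_equality)
    show "(K +> (\<ominus> a)) \<oplus>\<^bsub>?M\<^esub> (K +> a) = \<zero>\<^bsub>?M\<^esub>"
      using that by (simp add: add l_neg zero)
  qed (use that in auto)
  \<comment> \<open>The image of \<open>A\<close> in the quotient is a submodule that bounds
    \<open>A M\<close> from above. It misses the class of \<open>\<one>\<close>: otherwise
    \<open>\<one>\<close> would be a sum of elements of \<open>K\<close> and \<open>A\<close>, hence
    lie in \<open>A\<close>.\<close>
  have "submodule ((+>) K ` A) R ?M"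
  proof (rule M.submoduleI)
    show "\<zero>\<^bsub>?M\<^esub> \<in> (+>) K ` A"
      using zero[of "\<zero>"] by (auto intro!: image_eqI[of _ _ "\<zero>"])
  qed (auto simp: add inv smult A.I_l_closed)
  moreover have "a \<odot>\<^bsub>?M\<^esub> m \<in> (+>) K ` A" if "a \<in> A" "m \<in> carrier ?M" for a m
    using that by (auto simp: smult A.I_r_closed)
  ultimately have "smult_submodule R A ?M \<subseteq> (+>) K ` A"
    unfolding smult_submodule_def by blast
  moreover have "K +> \<one> \<notin> (+>) K ` A"
  proof
    assume "K +> \<one> \<in> (+>) K ` A"
    then obtain a where a: "a \<in> A" "K +> \<one> = K +> a" by blast
    then have "\<one> \<in> K +> a"
      using K.a_rcos_self[of \<one>] by simp
    then obtain k where "k \<in> K" "\<one> = k \<oplus> a"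
      by (auto simp: a_r_coset_def')
    then have "\<one> \<in> A"
      using a \<open>K \<subseteq> A\<close> by auto
    then show False
      using A.one_imp_carrier \<open>A \<noteq> carrier R\<close> by blast
  qed
  ultimately have proper: "smult_submodule R A ?M \<noteq> carrier ?M"
    by (metis image_eqI one_closed subsetD carrier_quot)
  have "xs = []" if "set xs \<subseteq> A" "regular_sequence R ?M xs" for xs
  proof (rule ccontr)
    assume "xs \<noteq> []"
    then have x: "xs ! 0 \<in> A"
      using that(1) by (cases xs) auto
    \<comment> \<open>At index 0 the preceding part of the sequence is empty, so regularity is
      tested against the zero submodule.\<close>
    have "(xs ! 0) \<odot>\<^bsub>?M\<^esub> (K +> u) \<in> {\<zero>\<^bsub>?M\<^esub>}"
      using x u socle by (simp add: smult zero)
    then have "K +> u \<in> {\<zero>\<^bsub>?M\<^esub>}"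
      using that(2) \<open>xs \<noteq> []\<close> u(1) unfolding regular_sequence_def
      by (auto simp: smult_submodule_empty[OF M.module_axioms] dest!: spec[of _ 0])
    then show False
      using u zero by simp
  qed
  then have "(SUP xs \<in> {xs. set xs \<subseteq> A \<and> regular_sequence R ?M xs}. enat (length xs)) \<le> 0"
    by (intro SUP_least) (auto simp: zero_enat_def)
  then show ?thesis
    using proper by (simp add: depth_def)
qed

section \<open>Ideals in type class notation\<close>

text \<open>Closure under negation comes from multiplying by -1, and commutativity turns absorption
  on one side into absorption on both.\<close>

lemma ideal_ring_of_type_algebra_iff:
  "ideal (I :: 'a::comm_ring_1 set) ring_of_type_algebra \<longleftrightarrow>
    0 \<in> I \<and> (\<forall>a\<in>I. \<forall>b\<in>I. a + b \<in> I) \<and> (\<forall>a\<in>I. \<forall>x. x * a \<in> I)"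
  (is "_ \<longleftrightarrow> ?rhs")
proof
  let ?R = "ring_of_type_algebra :: 'a ring"
  assume "ideal I ?R"
  then interpret I: ideal I ?R .
  show ?rhs
  proof (intro conjI ballI allI)
    show "0 \<in> I"
      using additive_subgroup.zero_closed[OF I.additive_subgroup_axioms]
      by (simp add: ring_of_type_algebra_def del: I.zero_closed)
    show "a + b \<in> I" if "a \<in> I" "b \<in> I" for a b
      using additive_subgroup.a_closed[OF I.additive_subgroup_axioms that]
      by (simp add: ring_of_type_algebra_def)
    show "x * a \<in> I" if "a \<in> I" for a x
      using I.I_l_closed[OF that, of x] by (simp add: ring_of_type_algebra_def)
  qed
next
  let ?R = "ring_of_type_algebra :: 'a ring"
  interpret R: cring ?R by (rule cring_from_type_algebra)
  assume I: ?rhs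
  have inv: "inv\<^bsub>add_monoid ?R\<^esub> a = - a" for a
    using R.minus_equality[of "- a" a] by (simp add: a_inv_def ring_of_type_algebra_def)
  have "- a \<in> I" if "a \<in> I" for a
    using I that mult_minus1[of a] by metis
  then have "subgroup I (add_monoid ?R)"
    using I by (intro subgroup.intro) (simp_all only: inv, auto simp: ring_of_type_algebra_def)
  then show "ideal I ?R"
    by (rule idealI[OF R.ring_axioms])
      (use I in \<open>auto simp: ring_of_type_algebra_def mult.commute\<close>)
qed

section \<open>Weights of monomials and the filtration by weight\<close>

definition mon_weight :: "('v \<Rightarrow> nat) \<Rightarrow> ('v \<Rightarrow>\<^sub>0 nat) \<Rightarrow> nat"
  where "mon_weight w m = (\<Sum>v\<in>Poly_Mapping.keys m. w v * Poly_Mapping.lookup m v)"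

lemma mon_weight_superset:
  "finite A \<Longrightarrow> Poly_Mapping.keys m \<subseteq> A \<Longrightarrow>
    mon_weight w m = (\<Sum>v\<in>A. w v * Poly_Mapping.lookup m v)"
  unfolding mon_weight_def by (intro sum.mono_neutral_left) (auto simp: in_keys_iff)

lemma mon_weight_add: "mon_weight w (a + b) = mon_weight w a + mon_weight w b"
  using keys_add[of a b]
  by (simp add: mon_weight_superset[of "Poly_Mapping.keys a \<union> Poly_Mapping.keys b"]
      lookup_add sum.distrib algebra_simps)

lemma mon_weight_0 [simp]: "mon_weight w 0 = 0"
  by (simp add: mon_weight_def)

lemma mon_weight_sum: "mon_weight w (sum g A) = (\<Sum>x\<in>A. mon_weight w (g x))"
  by (induction A rule: infinite_finite_induct) (auto simp: mon_weight_add)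

lemma mon_weight_single [simp]: "mon_weight w (Poly_Mapping.single v n) = w v * n"
  by (simp add: mon_weight_def)

lemma mon_weight_rename_mon: "mon_weight w (rename_mon f m) = mon_weight (\<lambda>v. w (f v)) m"
  by (simp add: rename_mon_def mon_weight_sum) (simp add: mon_weight_def)

lemma mon_weight_const: "mon_weight (\<lambda>_. c) m = c * mon_deg m"
  by (simp add: mon_weight_def mon_deg_def sum_distrib_left)

text \<open>The monomial ideal spanned by the monomials of weight at least \<open>n\<close>; zero,
  having no monomials, always belongs to it.\<close>

definition weight_ideal :: "('v \<Rightarrow> nat) \<Rightarrow> nat \<Rightarrow> ('v, 'k::field) mpoly set"
  where "weight_ideal w n = {p. \<forall>m\<in>Poly_Mapping.keys p. n \<le> mon_weight w m}"

lemma weight_ideal_mult: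
  assumes "p \<in> weight_ideal w a" "q \<in> weight_ideal w b"
  shows "p * q \<in> weight_ideal w (a + b)"
proof -
  have "a + b \<le> mon_weight w m" if "m \<in> Poly_Mapping.keys (p * q)" for m
    using that keys_mult[of p q] assms
    by (fastforce simp: weight_ideal_def mon_weight_add intro: add_mono)
  then show ?thesis
    by (simp add: weight_ideal_def)
qed

lemma weight_ideal_add:
  "p \<in> weight_ideal w n \<Longrightarrow> q \<in> weight_ideal w n \<Longrightarrow> p + q \<in> weight_ideal w n"
  using keys_add[of p q] by (auto simp: weight_ideal_def)

lemma ideal_weight_ideal: "ideal (weight_ideal w n :: ('v, 'k::field) mpoly set) mpoly_ring"
  unfolding ideal_ring_of_type_algebra_iff
proof (intro conjI ballI allI)
  fix a x :: "('v, 'k) mpoly"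
  assume "a \<in> weight_ideal w n"
  moreover have "x \<in> weight_ideal w 0"
    by (simp add: weight_ideal_def)
  ultimately show "x * a \<in> weight_ideal w n"
    using weight_ideal_mult by fastforce
qed (auto intro: weight_ideal_add, simp add: weight_ideal_def)

lemma keys_rename: "Poly_Mapping.keys (rename f p) \<subseteq> rename_mon f ` Poly_Mapping.keys p"
  unfolding rename_def
  by (rule order_trans[OF keys_sum]) (auto split: if_splits)

lemma rename_mem_weight_ideal:
  "p \<in> weight_ideal (\<lambda>v. w (f v)) n \<Longrightarrow> rename f p \<in> weight_ideal w n"
  using keys_rename[of f p] by (auto simp: weight_ideal_def mon_weight_rename_mon subset_iff)

lemma inj_rename_mon: "inj f \<Longrightarrow> inj (rename_mon f)"
  by (rule injI, rule poly_mapping_eqI) (metis lookup_rename_mon)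

text \<open>Injectivity keeps distinct monomials distinct, so no terms can cancel.\<close>

lemma rename_mon_mem_keys_rename:
  assumes "inj f" "m \<in> Poly_Mapping.keys p"
  shows "rename_mon f m \<in> Poly_Mapping.keys (rename f p)"
proof -
  have "Poly_Mapping.lookup (rename f p) (rename_mon f m) = Poly_Mapping.lookup p m"
    using assms inj_rename_mon[OF assms(1)]
    by (simp add: rename_def lookup_sum lookup_single when_def inj_eq)
  then show ?thesis
    using assms(2) by (simp add: in_keys_iff)
qed

text \<open>Translation of exponents by \<open>m\<close> is injective, so multiplying by one term
  only moves and scales coefficients. This lets a chosen monomial be followed through a
  product.\<close>

lemma lookup_times_single:
  "Poly_Mapping.lookup (p * Poly_Mapping.single m c) (n + m) = Poly_Mapping.lookup p n * c"
  for p :: "('v, 'k::field) mpoly"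
proof -
  have "Poly_Mapping.lookup (p * Poly_Mapping.single m c) (n + m) =
    Poly_Mapping.lookup (\<Sum>k\<in>Poly_Mapping.keys p.
      Poly_Mapping.single (k + m) (Poly_Mapping.lookup p k * c)) (n + m)"
    by (subst (1) mpoly_sum_single[of p, symmetric]) (simp add: sum_distrib_right mult_single)
  also have "\<dots> = Poly_Mapping.lookup p n * c"
    by (auto simp: lookup_sum lookup_single when_def in_keys_iff)
  finally show ?thesis .
qed

lemma add_mem_keys_times_single:
  "n \<in> Poly_Mapping.keys p \<Longrightarrow> n + m \<in> Poly_Mapping.keys (p * Poly_Mapping.single m 1)"
  for p :: "('v, 'k::field) mpoly"
  by (simp add: in_keys_iff lookup_times_single)

section \<open>Variables and the graded maximal ideal\<close>

abbreviation mvar :: "'v \<Rightarrow> ('v, 'k::field) mpoly"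
  where "mvar v \<equiv> Poly_Mapping.single (Poly_Mapping.single v 1) 1"

lemma mvar_mem_graded_max_ideal: "mvar v \<in> graded_max_ideal"
  by (simp add: graded_max_ideal_def mon_deg_def)

lemma graded_max_ideal_eq_weight_ideal: "graded_max_ideal = weight_ideal (\<lambda>_. 1) 1"
  by (auto simp: graded_max_ideal_def weight_ideal_def mon_weight_const Suc_le_eq)

lemma ideal_graded_max_ideal: "ideal (graded_max_ideal :: ('v, 'k::field) mpoly set) mpoly_ring"
  unfolding graded_max_ideal_eq_weight_ideal by (rule ideal_weight_ideal)

text \<open>Every monomial other than 1 is divisible by a variable. This reduces statements about
  the graded maximal ideal to statements about variables.\<close>

lemma graded_max_ideal_subset:
  fixes L :: "('v, 'k::field) mpoly set"
  assumes L: "ideal L mpoly_ring" and "\<And>v. mvar v \<in> L"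
  shows "graded_max_ideal \<subseteq> L"
proof
  note L = L[unfolded ideal_ring_of_type_algebra_iff]
  fix p :: "('v, 'k) mpoly"
  assume p: "p \<in> graded_max_ideal"
  have *: "Poly_Mapping.single m (Poly_Mapping.lookup p m) \<in> L"
    if m: "m \<in> Poly_Mapping.keys p" for m
  proof -
    have "m \<noteq> 0"
      using p m mon_deg_eq_0_iff[of m] unfolding graded_max_ideal_def by fastforce
    then obtain v where "Poly_Mapping.lookup m v \<noteq> 0"
      by (metis lookup_zero poly_mapping_eqI)
    \<comment> \<open>The truncated subtraction is exact because \<open>v\<close> occurs in
      \<open>m\<close>.\<close>
    then have "m = (m - Poly_Mapping.single v 1) + Poly_Mapping.single v 1"
      by (intro poly_mapping_eqI) (auto simp: lookup_add lookup_minus lookup_single when_def)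
    then have "Poly_Mapping.single m (Poly_Mapping.lookup p m) =
        Poly_Mapping.single (m - Poly_Mapping.single v 1) (Poly_Mapping.lookup p m) * mvar v"
      by (simp add: mult_single)
    then show ?thesis
      using L assms(2) by simp
  qed
  \<comment> \<open>Passing to partial sums over sets of monomials keeps \<open>p\<close> fixed in
    the induction.\<close>
  have "(\<Sum>m\<in>S. Poly_Mapping.single m (Poly_Mapping.lookup p m)) \<in> L"
    if "S \<subseteq> Poly_Mapping.keys p" "finite S" for S
    using that(2,1) by (induction) (use L * in auto)
  from this[OF order_refl] show "p \<in> L"
    by (simp add: mpoly_sum_single)
qed

section \<open>Powers of ideals\<close>

abbreviation ideal_power (infixr "^\<^sub>I" 80)
  where "F ^\<^sub>I s \<equiv> F [^]\<^bsub>ideals_set mpoly_ring\<^esub> (s::nat)"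

lemma monoid_ideals_set: "Group.monoid (ideals_set (ring_of_type_algebra :: 'a::comm_ring_1 ring))"
  using cring.ideals_set_is_comm_monoid[OF cring_from_type_algebra] comm_monoid.axioms(1) by blast

lemma ideal_ideal_power:
  "ideal (F :: ('v, 'k::field) mpoly set) mpoly_ring \<Longrightarrow> ideal (F ^\<^sub>I s) mpoly_ring"
  using Group.monoid.nat_pow_closed[OF monoid_ideals_set, of F s] by (simp add: ideals_set_def)

lemma ideal_power_0: "F ^\<^sub>I 0 = (UNIV :: ('v, 'k::field) mpoly set)"
  by (simp add: Group.monoid.nat_pow_0[OF monoid_ideals_set] ideals_set_def ring_of_type_algebra_def)

lemma ideal_power_Suc:
  "F ^\<^sub>I Suc s = ideal_prod mpoly_ring (F ^\<^sub>I s) (F :: ('v, 'k::field) mpoly set)"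
  by (simp add: Group.monoid.nat_pow_Suc[OF monoid_ideals_set]) (simp add: ideals_set_def)

lemma mult_mem_ideal_power_Suc:
  "p \<in> F ^\<^sub>I s \<Longrightarrow> q \<in> F \<Longrightarrow> p * q \<in> F ^\<^sub>I Suc s"
  for F :: "('v, 'k::field) mpoly set"
  unfolding ideal_power_Suc
  using ideal_prod.prod[of p "F ^\<^sub>I s" q F mpoly_ring] by (simp add: ring_of_type_algebra_def)

lemma mult_mem_ideal_power_2:
  "p \<in> F \<Longrightarrow> q \<in> F \<Longrightarrow> p * q \<in> F ^\<^sub>I 2" for F :: "('v, 'k::field) mpoly set"
  \<comment> \<open>The product is built as \<open>1 * p * q\<close>, starting from 1 in the zeroth
    power, which is the whole ring.\<close>
  using mult_mem_ideal_power_Suc[of p F "Suc 0" q] mult_mem_ideal_power_Suc[of 1 F 0 p]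
  by (simp only: ideal_power_0 numeral_2_eq_2 UNIV_I mult_1_left)

lemma ideal_power_Suc_induct [consumes 1, case_names prod sum]:
  assumes "p \<in> F ^\<^sub>I Suc s"
    and "\<And>a b. a \<in> F ^\<^sub>I s \<Longrightarrow> b \<in> F \<Longrightarrow> P (a * b)"
    and "\<And>a b. P a \<Longrightarrow> P b \<Longrightarrow> P (a + b)"
  shows "P (p :: ('v, 'k::field) mpoly)"
  using assms(1) unfolding ideal_power_Suc
  by (induction rule: ideal_prod.induct) (use assms(2,3) in \<open>auto simp: ring_of_type_algebra_def\<close>)

text \<open>Weights add under multiplication, and addition creates no monomial of smaller
  weight.\<close>

lemma ideal_power_weight_ideal:
  fixes F :: "('v, 'k::field) mpoly set"
  assumes "F \<subseteq> weight_ideal w d"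
  shows "F ^\<^sub>I s \<subseteq> weight_ideal w (s * d)"
proof (induction s)
  case 0
  show ?case by (auto simp: weight_ideal_def)
next
  case (Suc s)
  show ?case
  proof
    fix p assume "p \<in> F ^\<^sub>I Suc s"
    then show "p \<in> weight_ideal w (Suc s * d)"
    proof (induction rule: ideal_power_Suc_induct)
      case (prod a b)
      then show ?case
        using weight_ideal_mult[of a w "s * d" b d] assms Suc by (auto simp: add.commute)
    qed (rule weight_ideal_add)
  qed
qed


lemma mult_power_mem_ideal_power:
  "p \<in> F ^\<^sub>I s \<Longrightarrow> h \<in> F \<Longrightarrow> p * h ^ k \<in> F ^\<^sub>I (s + k)"
  for F :: "('v, 'k::field) mpoly set"
proof (induction k)
  case (Suc k)
  then have "p * h ^ k * h \<in> F ^\<^sub>I Suc (s + k)"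
    by (blast intro: mult_mem_ideal_power_Suc)
  then show ?case
    by (simp only: power_Suc2 mult.assoc add_Suc_right)
qed simp

lemma ideal_power_1: "ideal F mpoly_ring \<Longrightarrow> F ^\<^sub>I Suc 0 = (F :: ('v, 'k::field) mpoly set)"
  using Group.monoid.nat_pow_Suc[OF monoid_ideals_set, of F 0]
    Group.monoid.nat_pow_0[OF monoid_ideals_set, of F] Group.monoid.l_one[OF monoid_ideals_set, of F]
  by (simp add: ideals_set_def)

lemma rename_mvar: "rename f (mvar v) = mvar (f v)"
  by (simp add: rename_mon_def)

section \<open>Vanishing depth when the first ideal is non-zero\<close>

text \<open>The embeddings \<open>i\<close> and \<open>j\<close> of the variables are kept abstract,
  and \<open>F\<close> is described by elements it contains and by minimality. The two factors can
  then be interchanged, so that this one lemma covers both \<open>I \<noteq> {0}\<close> and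
  \<open>J \<noteq> {0}\<close> in the theorem.\<close>

lemma depth_fiber_product_power:
  fixes I :: "('x, 'k::field) mpoly set" and J :: "('y, 'k) mpoly set"
    and F :: "('w, 'k) mpoly set" and i :: "'x \<Rightarrow> 'w" and j :: "'y \<Rightarrow> 'w"
  assumes i: "inj i" and disj: "range i \<inter> range j = {}" and cover: "range i \<union> range j = UNIV"
    and I: "ideal I mpoly_ring" "I \<noteq> {0}" "I \<subseteq> graded_max_ideal ^\<^sub>I 2"
    and J: "J \<subseteq> graded_max_ideal ^\<^sub>I 2"
    and F: "ideal F mpoly_ring"
    and IF: "rename i ` I \<subseteq> F"
    and mn: "\<And>p q. p \<in> graded_max_ideal \<Longrightarrow> q \<in> graded_max_ideal \<Longrightarrow>
      rename i p * rename j q \<in> F"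
    and least: "\<And>N. ideal N mpoly_ring \<Longrightarrow> rename i ` I \<subseteq> N \<Longrightarrow> rename j ` J \<subseteq> N \<Longrightarrow>
      (\<And>p q. p \<in> graded_max_ideal \<Longrightarrow> q \<in> graded_max_ideal \<Longrightarrow>
        rename i p * rename j q \<in> N) \<Longrightarrow> F \<subseteq> N"
    and s: "s \<ge> 2"
  shows "depth mpoly_ring graded_max_ideal (quot_module mpoly_ring (F ^\<^sub>I s)) = 0"
proof -
  \<comment> \<open>Weight with all variables of weight 1 is the degree. The statement is
    polymorphic in the variables, so it serves both \<open>I\<close> and \<open>J\<close>.\<close>
  have square: "graded_max_ideal ^\<^sub>I 2 \<subseteq> weight_ideal (\<lambda>_. 1) 2"
    using ideal_power_weight_ideal[of graded_max_ideal "\<lambda>_. 1" 1 2]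
    by (simp add: graded_max_ideal_eq_weight_ideal)
  obtain g where "g \<in> I" "g \<noteq> 0"
    using I(1,2) unfolding ideal_ring_of_type_algebra_iff by blast
  then have ex: "\<exists>d. \<exists>f\<in>I. \<exists>m\<in>Poly_Mapping.keys f. mon_deg m = d"
    by (metis all_not_in_conv keys_eq_empty)
  define d where "d = (LEAST d. \<exists>f\<in>I. \<exists>m\<in>Poly_Mapping.keys f. mon_deg m = d)"
  obtain f m where f: "f \<in> I" "m \<in> Poly_Mapping.keys f" "mon_deg m = d"
    using LeastI_ex[OF ex] unfolding d_def by blast
  have d_le: "d \<le> mon_deg m'" if "p \<in> I" "m' \<in> Poly_Mapping.keys p" for p m'
    unfolding d_def using that by (blast intro: Least_le)
  have d: "d \<ge> 2"
    using f I(3) square by (fastforce simp: weight_ideal_def mon_weight_const)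

  define w where "w v = (if v \<in> range i then 1 else d - 1)" for v
  have w: "w (i a) = 1" "w (j b) = d - 1" for a b
    using disj by (auto simp: w_def)
  have in_i: "p \<in> weight_ideal (\<lambda>_. 1) e \<Longrightarrow> rename i p \<in> weight_ideal w e"
    and in_j: "q \<in> weight_ideal (\<lambda>_. d - 1) e \<Longrightarrow> rename j q \<in> weight_ideal w e" for p q e
    using rename_mem_weight_ideal[of p w i] rename_mem_weight_ideal[of q w j] by (simp_all only: w)
  have "F \<subseteq> weight_ideal w d"
  proof (rule least[OF ideal_weight_ideal])
    have "I \<subseteq> weight_ideal (\<lambda>_. 1) d"
      by (auto simp: weight_ideal_def mon_weight_const d_le)
    then show "rename i ` I \<subseteq> weight_ideal w d"
      by (blast intro: in_i)
    show "rename j ` J \<subseteq> weight_ideal w d"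
    proof safe
      fix q assume "q \<in> J"
      then have "q \<in> weight_ideal (\<lambda>_. 1) 2"
        using J square by blast
      \<comment> \<open>This is where \<open>d \<ge> 2\<close> matters: monomials of degree at least
        2 get weight at least \<open>2 * (d - 1)\<close>, which is at least
        \<open>d\<close>.\<close>
      moreover have "d \<le> (d - 1) * e" if "2 \<le> e" for e
        by (rule order_trans[OF _ mult_le_mono2[OF that]]) (use d in simp)
      ultimately have "q \<in> weight_ideal (\<lambda>_. d - 1) d"
        by (simp add: weight_ideal_def mon_weight_const)
      then show "rename j q \<in> weight_ideal w d"
        by (rule in_j)
    qed
  next
    fix p :: "('x, 'k) mpoly" and q :: "('y, 'k) mpoly"
    assume "p \<in> graded_max_ideal" "q \<in> graded_max_ideal"
    then have "p \<in> weight_ideal (\<lambda>_. 1) 1" "q \<in> weight_ideal (\<lambda>_. d - 1) (d - 1)"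
      by (auto simp: graded_max_ideal_def weight_ideal_def mon_weight_const)
    then have "rename i p \<in> weight_ideal w 1" "rename j q \<in> weight_ideal w (d - 1)"
      by (blast intro: in_i in_j)+
    then show "rename i p * rename j q \<in> weight_ideal w d"
      using weight_ideal_mult[of "rename i p" w 1 "rename j q" "d - 1"] d by simp
  qed
  then have Fs: "F ^\<^sub>I s \<subseteq> weight_ideal w (s * d)"
    by (rule ideal_power_weight_ideal)

  obtain k where k: "s = k + 2"
    using s by (metis add.commute le_Suc_ex)
  \<comment> \<open>Types are inhabited, so each factor has a variable; any choice will do.\<close>
  obtain a0 :: 'x and b0 :: 'y where True by blast
  define x y where "x = i a0" and "y = j b0"
  have mvar_F: "mvar (i a) * mvar (j b) \<in> F" for a b
    using mn[OF mvar_mem_graded_max_ideal mvar_mem_graded_max_ideal, of a b]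
    by (simp only: rename_mvar)
  define h :: "('w, 'k) mpoly" where "h = mvar x * mvar y"
  define u where "u = rename i f * mvar y * h ^ k"
  have h: "h \<in> F"
    unfolding h_def x_def y_def by (rule mvar_F)

  \<comment> \<open>The image of the monomial \<open>m\<close> of degree \<open>d\<close> is
    followed through the product: \<open>y\<close> adds weight \<open>d - 1\<close>, and each factor
    \<open>h\<close> adds \<open>1 + (d - 1)\<close>.\<close>
  have "\<exists>n\<in>Poly_Mapping.keys (rename i f * mvar y * h ^ l).
      mon_weight w n = d + (d - 1) + l * d" for l
  proof (induction l)
    case 0
    show ?case
      using add_mem_keys_times_single[OF rename_mon_mem_keys_rename[OF i f(2)],
          of "Poly_Mapping.single y 1"]
      by (auto simp: mon_weight_add mon_weight_rename_mon w mon_weight_const f y_def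
          intro!: bexI)
  next
    case (Suc l)
    then obtain n where n: "n \<in> Poly_Mapping.keys (rename i f * mvar y * h ^ l)"
      "mon_weight w n = d + (d - 1) + l * d" by blast
    have "rename i f * mvar y * h ^ Suc l = (rename i f * mvar y * h ^ l) *
        Poly_Mapping.single (Poly_Mapping.single x 1 + Poly_Mapping.single y 1) 1"
      by (simp add: h_def mult_single mult_ac)
    then show ?case
      using add_mem_keys_times_single[OF n(1),
          of "Poly_Mapping.single x 1 + Poly_Mapping.single y 1"] n(2) d
      by (auto simp: mon_weight_add w x_def y_def intro!: bexI)
  qed
  then obtain n where n: "n \<in> Poly_Mapping.keys u" "mon_weight w n = d + (d - 1) + k * d"
    unfolding u_def by blast
  \<comment> \<open>With \<open>s = k + 2\<close> the weight is exactly
    \<open>s * d - 1\<close>.\<close>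
  have "mon_weight w n < s * d"
    using n(2) d by (simp add: k)
  then have u: "u \<notin> F ^\<^sub>I s"
    using Fs n(1) by (force simp: weight_ideal_def)

  \<comment> \<open>By additivity it suffices to treat a product of two elements of the graded
    maximal ideal; each of them takes one of the two variables and so becomes an element of
    \<open>F\<close>.\<close>
  have square_F: "rename i p * (mvar (j b) * mvar (j b')) \<in> F ^\<^sub>I 2"
    if "p \<in> graded_max_ideal ^\<^sub>I 2" for p b b'
    using that unfolding numeral_2_eq_2
  proof (induction rule: ideal_power_Suc_induct)
    case (prod p q)
    then have "rename i p * mvar (j b) \<in> F" "rename i q * mvar (j b') \<in> F"
      using mn[OF _ mvar_mem_graded_max_ideal, of p b] mn[OF _ mvar_mem_graded_max_ideal, of q b']
      by (simp_all only: rename_mvar ideal_power_1[OF ideal_graded_max_ideal])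
    from mult_mem_ideal_power_2[OF this] show ?case
      by (simp only: rename_mult numeral_2_eq_2 mult_ac)
  next
    case (sum p q)
    then show ?case
      using ideal_ideal_power[OF F, of "Suc (Suc 0)"]
      unfolding ideal_ring_of_type_algebra_iff rename_add distrib_right by blast
  qed
  have "mvar z * u \<in> F ^\<^sub>I s" for z
  proof -
    consider a where "z = i a" | b where "z = j b"
      using cover by blast
    then show ?thesis
    proof cases
      case 1
      have "rename i f \<in> F ^\<^sub>I 1"
        using ideal_power_1[OF F] IF f(1) by auto
      \<comment> \<open>The factor \<open>y\<close> of \<open>u\<close> is paired with
        \<open>z\<close>. This gives \<open>1 + k + 1 = s\<close> factors from \<open>F\<close>:
        \<open>f\<close>, the \<open>k\<close> copies of \<open>h\<close>, and
        \<open>z y\<close>.\<close>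
      then have "(rename i f * h ^ k) * (mvar z * mvar y) \<in> F ^\<^sub>I Suc (1 + k)"
        unfolding 1 y_def by (intro mult_mem_ideal_power_Suc mult_power_mem_ideal_power h mvar_F)
      then show ?thesis
        by (simp add: u_def k mult_ac)
    next
      case 2
      have "rename i f * (mvar z * mvar y) * h ^ k \<in> F ^\<^sub>I (2 + k)"
        unfolding 2 y_def using I(3) f(1) by (intro mult_power_mem_ideal_power square_F h) auto
      then show ?thesis
        by (simp add: u_def k mult_ac)
    qed
  qed
  \<comment> \<open>This is the colon ideal of \<open>u\<close> into the power of \<open>F\<close>;
    it contains the graded maximal ideal as soon as it contains the variables.\<close>
  moreover have "ideal {p. p * u \<in> F ^\<^sub>I s} mpoly_ring"
    using ideal_ideal_power[OF F, of s]
    by (simp add: ideal_ring_of_type_algebra_iff distrib_right mult.assoc)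
  ultimately have "graded_max_ideal \<subseteq> {p. p * u \<in> F ^\<^sub>I s}"
    by (intro graded_max_ideal_subset) auto
  then have socle: "p * u \<in> F ^\<^sub>I s" if "p \<in> graded_max_ideal" for p
    using that by blast
  \<comment> \<open>The monomial 1 has weight 0, while \<open>s * d\<close> is positive. Together
    with \<open>Fs\<close> this places the power of \<open>F\<close> inside the graded maximal
    ideal.\<close>
  have "weight_ideal w (s * d) \<subseteq> graded_max_ideal"
    using d by (auto simp: weight_ideal_def graded_max_ideal_def k mon_deg_eq_0_iff
        intro!: gr0I)
  then show ?thesis
    using Fs u socle
    by (intro depth_quot_module_eq_0[where u = u] cring_from_type_algebra ideal_graded_max_ideal
        ideal_ideal_power F)
      (auto simp: ring_of_type_algebra_def graded_max_ideal_alt lookup_one set_eq_iff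
        intro: exI[of _ 1])
qed

section \<open>The sum of ideals in the tensor product\<close>

lemma set_add_ring_of_type_algebra:
  "A <+>\<^bsub>ring_of_type_algebra\<^esub> B = {a + b | a b. a \<in> A \<and> b \<in> (B :: 'a::comm_ring_1 set)}"
  by (auto simp: set_add_def' ring_of_type_algebra_def)

theorem proposition1p3:
  fixes I :: "('x::finite, 'k::field) mpoly set"
    and J :: "('y::finite, 'k) mpoly set"
    and F :: "('x + 'y, 'k) mpoly set"
    and s :: nat
  assumes "homogeneous_ideal I"
    and "homogeneous_ideal J"
    and "I \<subseteq> graded_max_ideal [^]\<^bsub>ideals_set mpoly_ring\<^esub> (2::nat)"
    and "J \<subseteq> graded_max_ideal [^]\<^bsub>ideals_set mpoly_ring\<^esub> (2::nat)"
    and "I \<noteq> {0} \<or> J \<noteq> {0}"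
    and "F = Idl\<^bsub>mpoly_ring\<^esub> (rename Inl ` I) <+>\<^bsub>mpoly_ring\<^esub> Idl\<^bsub>mpoly_ring\<^esub> (rename Inr ` J)
      <+>\<^bsub>mpoly_ring\<^esub>
        ideal_prod mpoly_ring
          (Idl\<^bsub>mpoly_ring\<^esub> (rename Inl ` (graded_max_ideal :: ('x, 'k) mpoly set)))
          (Idl\<^bsub>mpoly_ring\<^esub> (rename Inr ` (graded_max_ideal :: ('y, 'k) mpoly set)))"
    and "s \<ge> 2"
  shows "depth mpoly_ring graded_max_ideal
           (quot_module mpoly_ring (F [^]\<^bsub>ideals_set mpoly_ring\<^esub> s)) = 0"
proof -
  let ?R = "mpoly_ring :: ('x + 'y, 'k) mpoly ring"
  let ?m = "rename Inl ` (graded_max_ideal :: ('x, 'k) mpoly set)"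
  let ?n = "rename Inr ` (graded_max_ideal :: ('y, 'k) mpoly set)"
  interpret cring ?R
    by (rule cring_from_type_algebra)
  define A where "A = Idl\<^bsub>?R\<^esub> (rename Inl ` I)"
  define B where "B = Idl\<^bsub>?R\<^esub> (rename Inr ` J)"
  define P where "P = ideal_prod ?R (Idl\<^bsub>?R\<^esub> ?m) (Idl\<^bsub>?R\<^esub> ?n)"
  have F_def: "F = A <+>\<^bsub>?R\<^esub> B <+>\<^bsub>?R\<^esub> P"
    unfolding A_def B_def P_def by (rule assms)
  have subset_carrier: "S \<subseteq> carrier ?R" for S
    by (simp add: ring_of_type_algebra_def)
  have ideals: "ideal A ?R" "ideal B ?R" "ideal P ?R"
    unfolding A_def B_def P_def
    by (intro genideal_ideal ideal_prod_is_ideal subset_carrier)+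
  then have F: "ideal F ?R"
    unfolding F_def by (intro add_ideals)
  have "S \<subseteq> S <+>\<^bsub>?R\<^esub> N" "N \<subseteq> S <+>\<^bsub>?R\<^esub> N" if "ideal S ?R" "ideal N ?R" for S N
    using that unfolding set_add_ring_of_type_algebra ideal_ring_of_type_algebra_iff
    by (metis (mono_tags, lifting) add_0_left add_0_right mem_Collect_eq subsetI)+
  from this[OF ideals(1,2)] this[OF add_ideals[OF ideals(1,2)] ideals(3)]
  have summands: "A \<subseteq> F" "B \<subseteq> F" "P \<subseteq> F"
    unfolding F_def by blast+
  have IF: "rename Inl ` I \<subseteq> F" and JF: "rename Inr ` J \<subseteq> F"
    using summands genideal_self[OF subset_carrier] unfolding A_def B_def by blast+
  have mn: "rename Inl p * rename Inr q \<in> F"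
    if "p \<in> graded_max_ideal" "q \<in> graded_max_ideal" for p q
  proof -
    have "rename Inl p \<otimes>\<^bsub>?R\<^esub> rename Inr q \<in> P"
      unfolding P_def using that
      by (intro ideal_prod.prod genideal_self[OF subset_carrier, THEN subsetD] imageI)
    then show ?thesis
      using summands(3) by (auto simp: ring_of_type_algebra_def)
  qed
  \<comment> \<open>Only products of images of the two maximal ideals are assumed to lie in
    \<open>N\<close>, whereas \<open>P\<close> is built from products of elements of the extended
    ideals.\<close>
  have least: "F \<subseteq> N" if N: "ideal N ?R" and "rename Inl ` I \<subseteq> N" "rename Inr ` J \<subseteq> N"
    and prod: "\<And>p q. p \<in> graded_max_ideal \<Longrightarrow> q \<in> graded_max_ideal \<Longrightarrow>
      rename Inl p * rename Inr q \<in> N" for N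
  proof -
    note N' = N[unfolded ideal_ring_of_type_algebra_iff]
    have "A \<subseteq> N" "B \<subseteq> N"
      unfolding A_def B_def by (intro genideal_minimal that)+
    moreover have "P \<subseteq> N"
    proof
      fix t assume "t \<in> P"
      then show "t \<in> N"
        unfolding P_def
      proof (induction rule: ideal_prod.induct)
        case (prod a b)
        \<comment> \<open>The passage to extended ideals is made one factor at a time: the
          multipliers taking a fixed element into \<open>N\<close> form an ideal, so containing the
          generators is enough.\<close>
        have "ideal {a. a * rename Inr q \<in> N} ?R" for q
          using N' by (simp add: ideal_ring_of_type_algebra_iff distrib_right mult.assoc)
        then have "Idl\<^bsub>?R\<^esub> ?m \<subseteq> {a. a * rename Inr q \<in> N}" if "q \<in> graded_max_ideal" for q
          using that \<open>\<And>p q. p \<in> graded_max_ideal \<Longrightarrow> q \<in> graded_max_ideal \<Longrightarrow>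
            rename Inl p * rename Inr q \<in> N\<close> by (intro genideal_minimal) auto
        moreover have "ideal {b. a * b \<in> N} ?R"
          using N' by (simp add: ideal_ring_of_type_algebra_iff distrib_left mult.left_commute)
        ultimately have "Idl\<^bsub>?R\<^esub> ?n \<subseteq> {b. a * b \<in> N}"
          using prod(1) by (intro genideal_minimal) auto
        then show ?case
          using prod(2) by (auto simp: ring_of_type_algebra_def)
      next
        case (sum a b)
        then show ?case
          using N' by (simp add: ring_of_type_algebra_def)
      qed
    qed
    ultimately show ?thesis
      using N' unfolding F_def set_add_ring_of_type_algebra by blast
  qed
  note I = assms(1)[unfolded homogeneous_ideal_def, THEN conjunct1]
  note J = assms(2)[unfolded homogeneous_ideal_def, THEN conjunct1]
  have cover: "range Inl \<union> range Inr = (UNIV :: ('x + 'y) set)"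
    by (rule UNIV_sum[symmetric])
  from assms(5) show ?thesis
  proof
    assume "I \<noteq> {0}"
    then show ?thesis
      using I assms(3,4,7) F IF mn least cover
      by (intro depth_fiber_product_power[of Inl Inr I J F s]) auto
  next
    assume "J \<noteq> {0}"
    show ?thesis
    \<comment> \<open>The roles of the two factors are exchanged; commutativity matches the mixed
      products.\<close>
    proof (rule depth_fiber_product_power[of Inr Inl J I F s])
      fix N :: "('x + 'y, 'k) mpoly set"
      assume "ideal N ?R" "rename Inr ` J \<subseteq> N" "rename Inl ` I \<subseteq> N"
        and "\<And>p q. p \<in> graded_max_ideal \<Longrightarrow> q \<in> graded_max_ideal \<Longrightarrow>
          rename Inr p * rename Inl q \<in> N"
      then show "F \<subseteq> N"
        by (intro least) (simp_all add: mult.commute)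
    qed (use \<open>J \<noteq> {0}\<close> J assms(3,4,7) F JF mn cover in \<open>auto simp: mult.commute Un_commute\<close>)
  qed
qed

end
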